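(* For any graph $G$ with at least one edge and with no isolated edges, $$\chi_{1-vsdt}(G)\le 4\Delta(G),$$ where $\Delta(G)$ is the maximum degree of $G$.
   Context: All graphs are finite, simple and undirected. For a vertex $u$ of $G$, let $N\langle u\rangle = N[u]\cup\{uv : v\in N(u)\}$, where $N(u)$ and $N[u]=N(u)\cup\{u\}$ are the open and closed neighborhoods; so $N\langle u\rangle$ consists of $u$, its neighbors and its incident edges. A proper $\kappa$-total coloring of $G$ is a map $f:V(G)\cup E(G)\to\{1,\dots,\kappa\}$ such that any two adjacent vertices, any two edges sharing an endpoint, and any vertex and incident edge receive different colors. Put $C_f\langle u\rangle=\{f(x): x\in N\langle u\rangle\}$. For a graph $G$ with no isolated edges (no connected component is $K_2$), a $\kappa$-$D(1)$-VSDTC of $G$ ($1$-vertex-strongly-distinguishing total coloring) is a proper $\kappa$-total coloring $f$ such that $C_f\langle u\rangle\neq C_f\langle v\rangle$ for any two adjacent vertices $u,v$. $\chi_{1-vsdt}(G)$ is the minimum $\kappa$ for which $G$ admits a $\kappa$-$D(1)$-VSDTC. *)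

theory Defs
  imports Main
begin

definition simple_graph :: "'a set \<Rightarrow> 'a set set \<Rightarrow> bool" where
  "simple_graph V E \<longleftrightarrow> finite V \<and> (\<forall>e\<in>E. e \<subseteq> V \<and> card e = 2)"

definition nbh :: "'a set set \<Rightarrow> 'a \<Rightarrow> 'a set" where
  "nbh E u = {v. {u, v} \<in> E}"

definition closed_nbh :: "'a set set \<Rightarrow> 'a \<Rightarrow> 'a set" where
  "closed_nbh E u = insert u (nbh E u)"

definition vertex_degree :: "'a set set \<Rightarrow> 'a \<Rightarrow> nat" where
  "vertex_degree E u = card (nbh E u)"

definition max_degree :: "'a set \<Rightarrow> 'a set set \<Rightarrow> nat" where
  "max_degree V E = Max (vertex_degree E ` V)"

definition component_of :: "'a set set \<Rightarrow> 'a \<Rightarrow> 'a set" where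
  "component_of E u = {v. (u, v) \<in> {(x, y). {x, y} \<in> E}\<^sup>*}"

definition graph_components :: "'a set \<Rightarrow> 'a set set \<Rightarrow> 'a set set" where
  "graph_components V E = component_of E ` V"

definition induced_edges :: "'a set set \<Rightarrow> 'a set \<Rightarrow> 'a set set" where
  "induced_edges E W = {e \<in> E. e \<subseteq> W}"

text \<open>The complete graph on two vertices: its only edge is the whole vertex set \<open>W\<close>.\<close>

definition is_K2 :: "'a set \<Rightarrow> 'a set set \<Rightarrow> bool" where
  "is_K2 W F \<longleftrightarrow> card W = 2 \<and> F = {W}"

definition no_isolated_edges :: "'a set \<Rightarrow> 'a set set \<Rightarrow> bool" where
  "no_isolated_edges V E \<longleftrightarrow> (\<forall>C\<in>graph_components V E. \<not> is_K2 C (induced_edges E C))"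

text \<open>The disjoint union of vertices and edges is rendered by a sum type:
  \<open>Inl v\<close> is the vertex \<open>v\<close> and \<open>Inr e\<close> is the edge \<open>e\<close>.\<close>

definition elements :: "'a set \<Rightarrow> 'a set set \<Rightarrow> ('a + 'a set) set" where
  "elements V E = Inl ` V \<union> Inr ` E"

definition full_nbh :: "'a set set \<Rightarrow> 'a \<Rightarrow> ('a + 'a set) set" where
  "full_nbh E u = Inl ` closed_nbh E u \<union> Inr ` {{u, v} | v. v \<in> nbh E u}"

definition proper_total_coloring ::
    "'a set \<Rightarrow> 'a set set \<Rightarrow> nat \<Rightarrow> ('a + 'a set \<Rightarrow> nat) \<Rightarrow> bool" where
  "proper_total_coloring V E k f \<longleftrightarrow>
     f ` elements V E \<subseteq> {1..k} \<and>
     (\<forall>u v. {u, v} \<in> E \<longrightarrow> f (Inl u) \<noteq> f (Inl v)) \<and>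
     (\<forall>e\<in>E. \<forall>e'\<in>E. e \<noteq> e' \<and> e \<inter> e' \<noteq> {} \<longrightarrow> f (Inr e) \<noteq> f (Inr e')) \<and>
     (\<forall>e\<in>E. \<forall>u\<in>e. f (Inl u) \<noteq> f (Inr e))"

definition color_set :: "'a set set \<Rightarrow> ('a + 'a set \<Rightarrow> nat) \<Rightarrow> 'a \<Rightarrow> nat set" where
  "color_set E f u = f ` full_nbh E u"

definition D1_VSDTC ::
    "'a set \<Rightarrow> 'a set set \<Rightarrow> nat \<Rightarrow> ('a + 'a set \<Rightarrow> nat) \<Rightarrow> bool" where
  "D1_VSDTC V E k f \<longleftrightarrow> proper_total_coloring V E k f \<and>
     (\<forall>u v. {u, v} \<in> E \<longrightarrow> color_set E f u \<noteq> color_set E f v)"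

text \<open>Only meaningful for graphs without isolated edges: for those, the set over which the
  minimum is taken is nonempty, as shown in \<open>D1_VSDTC_exists\<close> below.\<close>

definition chi_1vsdt :: "'a set \<Rightarrow> 'a set set \<Rightarrow> nat" where
  "chi_1vsdt V E = (LEAST k. \<exists>f. D1_VSDTC V E k f)"

lemma full_nbh_subset:
  assumes "simple_graph V E" "u \<in> V"
  shows "full_nbh E u \<subseteq> elements V E"
  using assms unfolding simple_graph_def full_nbh_def elements_def closed_nbh_def nbh_def by auto

lemma full_nbh_eq_isolated:
  assumes G: "simple_graph V E" and uv: "{u, v} \<in> E" and eq: "full_nbh E u = full_nbh E v"
  shows "\<not> no_isolated_edges V E"
proof -
  have "card {u, v} = 2" "{u, v} \<subseteq> V"
    using G uv unfolding simple_graph_def by blast+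
  then have ne: "u \<noteq> v" and uV: "u \<in> V" by auto
  have edges: "{{u, w} | w. {u, w} \<in> E} = {{v, w} | w. {v, w} \<in> E}"
  proof -
    have "Inr -` full_nbh E u = Inr -` full_nbh E v" using eq by simp
    moreover have "Inr -` full_nbh E x = {{x, w} | w. {x, w} \<in> E}" for x
      unfolding full_nbh_def nbh_def by blast
    ultimately show ?thesis by simp
  qed
  have nu: "w = v" if "{u, w} \<in> E" for w
  proof -
    have "{u, w} \<in> {{v, w} | w. {v, w} \<in> E}" using that edges by blast
    then show ?thesis using ne by auto
  qed
  have nv: "w = u" if "{v, w} \<in> E" for w
  proof -
    have "{v, w} \<in> {{u, w} | w. {u, w} \<in> E}" using that edges by blast
    then show ?thesis using ne by auto
  qed
  have "x \<in> {u, v}" if "(u, x) \<in> {(x, y). {x, y} \<in> E}\<^sup>*" for x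
    using that by induction (use nu nv in auto)
  then have C: "component_of E u = {u, v}"
    unfolding component_of_def using uv by auto
  have "e = {u, v}" if "e \<in> E" "e \<subseteq> {u, v}" for e
  proof (rule card_subset_eq)
    show "finite {u, v}" "e \<subseteq> {u, v}" using that by simp_all
    show "card e = card {u, v}" using that G ne unfolding simple_graph_def by simp
  qed
  then have "is_K2 {u, v} (induced_edges E {u, v})"
    using ne uv unfolding is_K2_def induced_edges_def by auto
  then have "is_K2 (component_of E u) (induced_edges E (component_of E u))"
    by (simp only: C)
  then show ?thesis
    using uV unfolding no_isolated_edges_def graph_components_def by blast
qed

lemma D1_VSDTC_exists:
  assumes G: "simple_graph V E" and I: "no_isolated_edges V E"
  shows "\<exists>k f. D1_VSDTC V E k f"
proof -
  let ?X = "elements V E"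
  have "E \<subseteq> Pow V" "finite V" using G unfolding simple_graph_def by auto
  then have "finite ?X" unfolding elements_def by (auto intro: finite_subset)
  from ex_bij_betw_finite_nat[OF this] obtain g
    where g: "inj_on g ?X" "g ` ?X = {0..<card ?X}" unfolding bij_betw_def by auto
  define f where "f x = Suc (g x)" for x
  have inj: "inj_on f ?X" using g(1) unfolding f_def inj_on_def by auto
  have im: "f ` ?X \<subseteq> {1..card ?X}"
  proof
    fix y assume "y \<in> f ` ?X"
    then obtain x where "x \<in> ?X" "y = Suc (g x)" unfolding f_def by blast
    moreover from this have "g x \<in> {0..<card ?X}" using g(2) by blast
    ultimately show "y \<in> {1..card ?X}" by simp
  qed
  have V: "u \<in> V" if "e \<in> E" "u \<in> e" for u e
    using that G unfolding simple_graph_def by blast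
  have ne: "u \<noteq> v" if "{u, v} \<in> E" for u v
  proof -
    have "card {u, v} = 2" using that G unfolding simple_graph_def by blast
    then show ?thesis by auto
  qed
  have X: "Inl u \<in> ?X \<longleftrightarrow> u \<in> V" "Inr e \<in> ?X \<longleftrightarrow> e \<in> E" for u e
    unfolding elements_def by auto
  have fne: "f x \<noteq> f y" if "x \<in> ?X" "y \<in> ?X" "x \<noteq> y" for x y
    using inj that unfolding inj_on_def by blast
  have "proper_total_coloring V E (card ?X) f"
    unfolding proper_total_coloring_def
  proof (intro conjI allI ballI impI)
    show "f ` ?X \<subseteq> {1..card ?X}" by (rule im)
    show "f (Inl u) \<noteq> f (Inl v)" if "{u, v} \<in> E" for u v
      using that V[OF that] ne[OF that] by (intro fne) (auto simp: X)
    show "f (Inr e) \<noteq> f (Inr e')"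
      if "e \<in> E" "e' \<in> E" "e \<noteq> e' \<and> e \<inter> e' \<noteq> {}" for e e'
      using that by (intro fne) (auto simp: X)
    show "f (Inl u) \<noteq> f (Inr e)" if "e \<in> E" "u \<in> e" for e u
      using that V[OF that] by (intro fne) (auto simp: X)
  qed
  moreover have "color_set E f u \<noteq> color_set E f v" if "{u, v} \<in> E" for u v
  proof -
    have "full_nbh E u \<noteq> full_nbh E v" using full_nbh_eq_isolated[OF G that] I by auto
    moreover have "u \<in> V" "v \<in> V" using V that by blast+
    ultimately show ?thesis
      unfolding color_set_def using inj_on_image_eq_iff[OF inj] full_nbh_subset[OF G] by blast
  qed
  ultimately show ?thesis unfolding D1_VSDTC_def by blast
qed

end

theory Submission
  imports Defs
begin

text \<open>
  Use disjoint palettes \<open>A\<close> of \<open>\<Delta> + 1\<close> and \<open>B\<close> of \<open>3\<Delta> - 1\<close> colours. In every component with an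
  edge choose a vertex \<open>r\<close> that is not a cut vertex and a neighbour \<open>c\<close> of \<open>r\<close>. The vertices, and then
  the edges at \<open>r\<close> other than \<open>rc\<close>, are coloured greedily from \<open>A\<close>. The remaining edges form a graph
  \<open>H\<close> that is connected on each component; they are coloured greedily from \<open>B\<close>, in the reverse of an
  order that starts with \<open>rc\<close> and in which every further edge meets an earlier one. Then each edge
  other than \<open>rc\<close> completes at most one of its end points, so that at most \<open>2(\<Delta> - 1)\<close> colours are
  excluded by adjacent edges and at most \<open>\<Delta> - 1\<close> by completed neighbours of that end point. The edge
  \<open>rc\<close> completes both end points, but it is the only edge of \<open>H\<close> at \<open>r\<close>: only \<open>\<Delta> - 1\<close> colours are
  excluded by adjacent edges and \<open>2(\<Delta> - 1)\<close> by completed neighbours, while \<open>r\<close> and \<open>c\<close> are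
  distinguished by the number of colours from \<open>B\<close>.
\<close>

section \<open>Greedy colouring of conflict relations\<close>

definition inc :: "'a set set \<Rightarrow> 'a \<Rightarrow> 'a set set" where
  "inc H u = {e \<in> H. u \<in> e}"

lemma ex_colour_avoiding:
  assumes "finite S" "card S < card A"
  shows "\<exists>c\<in>A. c \<notin> S"
  using assms card_mono[of S A] by (meson linorder_not_le subsetI)

text \<open>Induction on \<open>X\<close>, colouring the new element last: its prescribed set
  \<open>P x\<close> and the colours of its conflicting elements do not exhaust \<open>A\<close>.
  Conflicts within a smaller set are only fewer, so the bound is inherited, and symmetry of
  \<open>K\<close> makes the new colour acceptable to the old elements as well. For edges,
  \<open>P\<close> will hold the colours of the end points.\<close>

lemma greedy_colouring:
  assumes "finite X" "symp K"
    and "\<And>x. x \<in> X \<Longrightarrow> finite (P x)"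
    and "\<And>x. x \<in> X \<Longrightarrow> card (P x) + card {y \<in> X. y \<noteq> x \<and> K x y} < card A"
  shows "\<exists>g. \<forall>x\<in>X. g x \<in> A \<and> g x \<notin> P x \<and> (\<forall>y\<in>X. y \<noteq> x \<and> K x y \<longrightarrow> g x \<noteq> g y)"
  using assms(1,3,4)
proof (induction X rule: finite_induct)
  case empty
  then show ?case by simp
next
  case (insert x X)
  have "card (P y) + card {z \<in> X. z \<noteq> y \<and> K y z} < card A" if "y \<in> X" for y
  proof -
    have "card {z \<in> X. z \<noteq> y \<and> K y z} \<le> card {z \<in> insert x X. z \<noteq> y \<and> K y z}"
      using insert.hyps by (intro card_mono) auto
    then show ?thesis using insert.prems(2)[of y] that by simp
  qed
  then obtain g where g: "\<forall>y\<in>X. g y \<in> A \<and> g y \<notin> P y \<and> (\<forall>z\<in>X. z \<noteq> y \<and> K y z \<longrightarrow> g y \<noteq> g z)"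
    using insert.IH insert.prems(1) by auto
  let ?N = "{y \<in> insert x X. y \<noteq> x \<and> K x y}"
  have fin: "finite (P x \<union> g ` ?N)" using insert.prems(1) insert.hyps by auto
  have "card (P x \<union> g ` ?N) \<le> card (P x) + card ?N"
    using insert.hyps by (intro order_trans[OF card_Un_le] add_left_mono card_image_le) simp
  also have "\<dots> < card A" using insert.prems(2) by blast
  finally obtain c where c: "c \<in> A" "c \<notin> P x \<union> g ` ?N"
    using ex_colour_avoiding[OF fin] by blast
  have new: "c \<noteq> g y" if "y \<in> X" "K x y" for y
    using c(2) that insert.hyps by auto
  have "g y \<noteq> c" if "y \<in> X" "K y x" for y
    using new[OF that(1)] sympD[OF assms(2) that(2)] by metis
  then have "\<forall>y\<in>insert x X. (g(x := c)) y \<in> A \<and> (g(x := c)) y \<notin> P y \<and>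
      (\<forall>z\<in>insert x X. z \<noteq> y \<and> K y z \<longrightarrow> (g(x := c)) y \<noteq> (g(x := c)) z)"
    using g c new insert.hyps by auto
  then show ?case by blast
qed

section \<open>Extending a distinguishing edge colouring by one edge\<close>

text \<open>Invariant of a partial colouring of \<open>H\<close>, with \<open>D\<close> the edges
  coloured so far. A vertex is judged only once it is complete, that is once all edges of
  \<open>H\<close> at it are coloured. The pairs to be distinguished are the edges of the whole
  graph, not only those of \<open>H\<close>.\<close>

definition distinguishing_on ::
    "'a set set \<Rightarrow> 'a set set \<Rightarrow> 'c set \<Rightarrow> 'a set set \<Rightarrow> ('a set \<Rightarrow> 'c) \<Rightarrow> bool" where
  "distinguishing_on E H B D b \<longleftrightarrow> b ` D \<subseteq> B \<and>
     (\<forall>e\<in>D. \<forall>e'\<in>D. e \<noteq> e' \<and> e \<inter> e' \<noteq> {} \<longrightarrow> b e \<noteq> b e') \<and>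
     (\<forall>u v. {u, v} \<in> E \<and> inc H u \<subseteq> D \<and> inc H v \<subseteq> D \<longrightarrow> b ` inc H u \<noteq> b ` inc H v)"

text \<open>If \<open>e\<close> is the last edge at \<open>v\<close> to be coloured, then a completed neighbour \<open>w\<close> of \<open>v\<close> rules
  out at most one colour for \<open>e\<close>: the one by which the colours at \<open>w\<close> exceed those already present
  at \<open>v\<close>. (If there is no such unique colour, \<open>the_elem\<close> blocks an irrelevant one.)\<close>

definition blocked :: "'a set set \<Rightarrow> 'a set set \<Rightarrow> ('a set \<Rightarrow> 'c) \<Rightarrow> 'a set \<Rightarrow> 'a \<Rightarrow> 'c set" where
  "blocked E H b e v = (\<lambda>w. the_elem (b ` inc H w - b ` (inc H v - {e}))) ` (nbh E v - e)"

lemma insert_eq_the_elem: "c \<notin> T \<Longrightarrow> insert c T = S \<Longrightarrow> c = the_elem (S - T)"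
  by (metis Diff_insert_absorb insert_Diff_if insert_Diff_single Diff_cancel empty_iff the_elem_eq)

text \<open>Only colour sets at the two ends of \<open>e\<close> change. A pair with one end in
  \<open>e\<close> is separated because \<open>c\<close> is not blocked. The ends of
  \<open>e\<close> itself share the colour \<open>c\<close>, so no choice of \<open>c\<close>
  settles that pair; it relies on \<open>deg\<close>, which matters only if \<open>e\<close>
  completes both ends.\<close>

lemma distinguishing_on_extend:
  assumes b: "distinguishing_on E H B D b"
    and "e \<in> H" "e \<notin> D"
    and e: "e = {x, y}" and loop: "\<And>u. {u} \<notin> E"
    and c: "c \<in> B" "c \<notin> b ` {e' \<in> D. e' \<inter> e \<noteq> {}}"
      "\<And>v. v \<in> e \<Longrightarrow> inc H v \<subseteq> insert e D \<Longrightarrow> c \<notin> blocked E H b e v"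
    and deg: "inc H x \<subseteq> insert e D \<Longrightarrow> inc H y \<subseteq> insert e D \<Longrightarrow> card (inc H x) \<noteq> card (inc H y)"
  shows "\<exists>b'. distinguishing_on E H B (insert e D) b'"
proof -
  let ?b = "b(e := c)"
  have range: "?b ` insert e D \<subseteq> B"
    using b c(1) unfolding distinguishing_on_def by auto
  have proper: "?b f \<noteq> ?b f'" if "f \<in> insert e D" "f' \<in> insert e D" "f \<noteq> f'" "f \<inter> f' \<noteq> {}" for f f'
  proof -
    have "c \<noteq> b f''" if "f'' \<in> D" "f'' \<inter> e \<noteq> {}" for f'' using c(2) that by blast
    moreover have "b f \<noteq> b f'" if "f \<in> D" "f' \<in> D"
      using b that \<open>f \<noteq> f'\<close> \<open>f \<inter> f' \<noteq> {}\<close> unfolding distinguishing_on_def by blast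
    ultimately show ?thesis using that \<open>e \<notin> D\<close> by (metis Int_commute fun_upd_apply insertE)
  qed
  \<comment> \<open>Edges at one vertex meet pairwise, so a proper colouring is injective on them
    and unequal degrees in \<open>H\<close> give unequal colour sets.\<close>
  have card_b: "card (?b ` inc H u) = card (inc H u)" if "inc H u \<subseteq> insert e D" for u
  proof (rule card_image, rule inj_onI, rule ccontr)
    fix f f' assume f: "f \<in> inc H u" "f' \<in> inc H u" "?b f = ?b f'" "f \<noteq> f'"
    then have "f \<inter> f' \<noteq> {}" unfolding inc_def by auto
    then show False using proper[of f f'] f that by blast
  qed
  have same: "?b ` inc H u = b ` inc H u" if "u \<notin> e" for u
  proof -
    have "e \<notin> inc H u" using that unfolding inc_def by auto
    then show ?thesis by (metis fun_upd_image)
  qed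
  have one: "?b ` inc H u \<noteq> ?b ` inc H v"
    if "{u, v} \<in> E" "inc H u \<subseteq> insert e D" "u \<in> e" "v \<notin> e" for u v
  proof
    assume eq: "?b ` inc H u = ?b ` inc H v"
    have "e \<in> inc H u" using \<open>e \<in> H\<close> that(3) unfolding inc_def by auto
    then have "?b ` inc H u = insert c (b ` (inc H u - {e}))" by (auto simp: fun_upd_image)
    moreover have "c \<notin> b ` (inc H u - {e})"
    proof -
      have "inc H u - {e} \<subseteq> {e' \<in> D. e' \<inter> e \<noteq> {}}"
        using that(2,3) unfolding inc_def by auto
      then show ?thesis using c(2) by blast
    qed
    ultimately have "c = the_elem (b ` inc H v - b ` (inc H u - {e}))"
      using eq same[OF that(4)] insert_eq_the_elem by metis
    moreover have "v \<in> nbh E u - e" using that unfolding nbh_def by auto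
    ultimately have "c \<in> blocked E H b e u" unfolding blocked_def by blast
    then show False using c(3) that by blast
  qed
  have "?b ` inc H u \<noteq> ?b ` inc H v"
    if uv: "{u, v} \<in> E" "inc H u \<subseteq> insert e D" "inc H v \<subseteq> insert e D" for u v
  proof -
    consider "u \<in> e" "v \<in> e" | "u \<in> e" "v \<notin> e" | "u \<notin> e" "v \<in> e" | "u \<notin> e" "v \<notin> e" by blast
    then show ?thesis
    proof cases
      case 1
      have "u \<noteq> v" using uv(1) loop by auto
      then have "card (inc H u) \<noteq> card (inc H v)" using 1 e deg uv by auto
      then show ?thesis using card_b uv by metis
    next
      case 2
      then show ?thesis using one uv by blast
    next
      case 3
      then show ?thesis using one[of v u] uv by (metis insert_commute)
    next
      case 4
      then have "inc H u \<subseteq> D" "inc H v \<subseteq> D" using uv unfolding inc_def by auto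
      then have "b ` inc H u \<noteq> b ` inc H v"
        using b uv(1) unfolding distinguishing_on_def by blast
      then show ?thesis using same 4 by simp
    qed
  qed
  then have "distinguishing_on E H B (insert e D) ?b"
    unfolding distinguishing_on_def using range proper
    by (intro conjI ballI allI impI; (elim conjE)?) simp_all
  then show ?thesis by blast
qed

section \<open>Orders in which the edges are coloured\<close>

text \<open>Reading the construction of a grown edge set backwards gives the colouring order: apart from the
  edges in \<open>Z\<close>, each edge meets an edge that is coloured later, and so completes at most one of its
  end points.\<close>

inductive grown :: "'a set set \<Rightarrow> 'a set set \<Rightarrow> 'a set set \<Rightarrow> bool" for H Z where
  empty: "grown H Z {}"
| step: "grown H Z U \<Longrightarrow> e \<in> H \<Longrightarrow> e \<notin> U \<Longrightarrow> e \<in> Z \<or> e \<inter> \<Union>U \<noteq> {} \<Longrightarrow> grown H Z (insert e U)"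

lemma grown_subset: "grown H Z U \<Longrightarrow> U \<subseteq> H"
  by (induction rule: grown.induct) auto

lemma grown_all:
  assumes "finite H" and ext: "\<And>U. U \<subset> H \<Longrightarrow> \<exists>e\<in>H - U. e \<in> Z \<or> e \<inter> \<Union>U \<noteq> {}"
  shows "grown H Z H"
proof -
  have "grown H Z H" if "grown H Z U" for U
    using that
  proof (induction "card (H - U)" arbitrary: U rule: less_induct)
    case less
    show ?case
    proof (cases "U = H")
      case True
      then show ?thesis using less.prems by simp
    next
      case False
      then have "U \<subset> H" using grown_subset[OF less.prems] by (rule psubsetI[rotated])
      from ext[OF this] obtain e where e: "e \<in> H - U" "e \<in> Z \<or> e \<inter> \<Union>U \<noteq> {}" by (rule bexE)
      have "H - insert e U \<subset> H - U" using e(1) by (metis Diff_iff Diff_insert Diff_subset insertI1 psubsetI)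
      then have "card (H - insert e U) < card (H - U)" using assms(1) by (simp add: psubset_card_mono)
      moreover have "grown H Z (insert e U)" using e(1) by (intro grown.step[OF less.prems _ _ e(2)]) simp_all
      ultimately show ?thesis by (rule less.hyps)
    qed
  qed
  then show ?thesis using grown.empty .
qed

section \<open>Degree bounds and counts of excluded colours\<close>

text \<open>Here \<open>d\<close> is any upper bound on the degrees; the maximum degree is
  substituted only in the final theorem.\<close>

locale sgraph =
  fixes V :: "'a set" and E :: "'a set set" and d :: nat
  assumes G: "simple_graph V E"
    and degree_le: "\<And>u. u \<in> V \<Longrightarrow> vertex_degree E u \<le> d"
begin

lemma finite_V: "finite V" and finite_E: "finite E"
proof -
  show "finite V" using G unfolding simple_graph_def by simp
  moreover have "E \<subseteq> Pow V" using G unfolding simple_graph_def by auto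
  ultimately show "finite E" by (meson finite_Pow_iff finite_subset)
qed

lemma edge_V: "e \<in> E \<Longrightarrow> u \<in> e \<Longrightarrow> u \<in> V"
  using G unfolding simple_graph_def by blast

lemma edge_ne: "{u, v} \<in> E \<Longrightarrow> u \<noteq> v"
  using G unfolding simple_graph_def by fastforce

lemma no_loop: "{u} \<notin> E"
  using edge_ne[of u u] by auto

lemma edgeE:
  assumes "e \<in> E" "u \<in> e"
  obtains v where "e = {u, v}" "u \<noteq> v"
proof -
  have "card e = 2" using assms G unfolding simple_graph_def by blast
  then obtain x y where "e = {x, y}" "x \<noteq> y" by (auto simp: card_2_iff)
  then show ?thesis using that assms(2) by (metis insert_commute insert_iff singletonD)
qed

lemma finite_nbh: "finite (nbh E u)"
proof (rule finite_subset)
  show "nbh E u \<subseteq> V" unfolding nbh_def using edge_V by blast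
qed (rule finite_V)

lemma card_nbh: "u \<in> V \<Longrightarrow> card (nbh E u) \<le> d"
  using degree_le unfolding vertex_degree_def .

lemma finite_inc: "H \<subseteq> E \<Longrightarrow> finite (inc H u)"
  using finite_E unfolding inc_def by (auto intro: finite_subset)

lemma card_inc:
  assumes "H \<subseteq> E" "u \<in> V"
  shows "card (inc H u) \<le> d"
proof -
  have "inc H u \<subseteq> (\<lambda>v. {u, v}) ` nbh E u"
  proof
    fix e assume "e \<in> inc H u"
    then have e: "e \<in> E" "u \<in> e" using assms unfolding inc_def by auto
    then obtain v where "e = {u, v}" by (rule edgeE)
    then show "e \<in> (\<lambda>v. {u, v}) ` nbh E u" using e unfolding nbh_def by auto
  qed
  then have "card (inc H u) \<le> card (nbh E u)" by (rule surj_card_le[OF finite_nbh])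
  then show ?thesis using card_nbh[OF assms(2)] by simp
qed

text \<open>The other end of \<open>e\<close> is a neighbour of \<open>v\<close> that blocks
  nothing, which leaves at most \<open>d - 1\<close> neighbours.\<close>

lemma card_blocked:
  assumes "e \<in> E" "v \<in> e"
  shows "finite (blocked E H b e v)" "card (blocked E H b e v) \<le> d - 1"
proof -
  obtain w where w: "e = {v, w}" using assms by (rule edgeE)
  have "nbh E v - e \<subseteq> nbh E v - {w}" "w \<in> nbh E v"
    using w assms unfolding nbh_def by auto
  then have "card (nbh E v - e) \<le> card (nbh E v) - 1"
    by (metis card_Diff_singleton card_mono finite_Diff finite_nbh)
  also have "\<dots> \<le> d - 1" using card_nbh edge_V assms by (meson diff_le_mono)
  finally show "card (blocked E H b e v) \<le> d - 1"
    unfolding blocked_def using card_image_le[of "nbh E v - e"] finite_nbh by (meson finite_Diff le_trans)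
  show "finite (blocked E H b e v)" unfolding blocked_def using finite_nbh by auto
qed

lemma card_inc_minus:
  assumes "H \<subseteq> E" "e \<in> H" "v \<in> e"
  shows "card (inc H v - {e}) \<le> d - 1"
proof -
  have "e \<in> inc H v" "v \<in> V" using assms edge_V unfolding inc_def by auto
  then show ?thesis using card_inc[OF assms(1)] by (simp add: diff_le_mono)
qed

section \<open>Colouring all of \<open>H\<close>\<close>

text \<open>\<open>U\<close> is the set of edges still uncoloured. The edge that entered
  \<open>U\<close> last is coloured first, and the induction hypothesis then colours the smaller set
  that remains.\<close>

lemma distinguishing_on_all:
  assumes H: "H \<subseteq> E" and B: "3 * (d - 1) < card B"
    and root: "\<And>z. z \<in> Z \<Longrightarrow> \<exists>r c. z = {r, c} \<and> inc H r = {z} \<and> inc H c \<noteq> {z}"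
    and grown: "grown H Z U"
  shows "distinguishing_on E H B (H - U) b \<Longrightarrow> \<exists>b. distinguishing_on E H B H b"
  using grown
proof (induction arbitrary: b rule: grown.induct)
  case empty
  then show ?case by auto
next
  case (step U e b)
  let ?D = "H - insert e U"
  have e: "e \<in> E" "e \<in> H" using step H by auto
  have D: "insert e ?D = H - U" using step.hyps by auto
  have d: "0 < d"
  proof -
    have "card e = 2" using e(1) G unfolding simple_graph_def by blast
    then obtain u where u: "u \<in> e" by fastforce
    then have "e \<in> inc H u" using e unfolding inc_def by auto
    then have "0 < card (inc H u)" using finite_inc[OF H] card_gt_0_iff by blast
    then show ?thesis using card_inc[OF H edge_V[OF e(1) u]] by simp
  qed
  have adj: "{e' \<in> ?D. e' \<inter> e \<noteq> {}} \<subseteq> (inc H x - {e}) \<union> (inc H y - {e})" if "e = {x, y}" for x y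
    using that unfolding inc_def by auto
  let ?N = "{e' \<in> ?D. e' \<inter> e \<noteq> {}}"
  have fin_N: "finite ?N"
    by (intro finite_subset[OF _ finite_subset[OF H finite_E]]) auto
  have "\<exists>b'. distinguishing_on E H B (insert e ?D) b'"
  proof (cases "e \<in> Z")
    case True
    then obtain r c where rc: "e = {r, c}" "inc H r = {e}" "inc H c \<noteq> {e}"
      using root[OF True] by (elim exE conjE)
    have r: "r \<in> e" and c: "c \<in> e" using rc(1) by auto
    \<comment> \<open>\<open>e\<close> is the only edge of \<open>H\<close> at \<open>r\<close>, so
      all its coloured neighbours are at \<open>c\<close>.\<close>
    have "?N \<subseteq> inc H c - {e}" using adj[OF rc(1)] rc(2) by auto
    then have "card ?N \<le> card (inc H c - {e})"
      using finite_inc[OF H] by (intro card_mono) simp_all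
    then have "card (b ` ?N) \<le> d - 1"
      using card_inc_minus[OF H e(2) c] card_image_le[OF fin_N, of b] by linarith
    then have lt: "card (b ` ?N \<union> (blocked E H b e r \<union> blocked E H b e c)) < card B"
      using card_blocked(2)[OF e(1) r, of H b] card_blocked(2)[OF e(1) c, of H b] B d
        card_Un_le[of "b ` ?N" "blocked E H b e r \<union> blocked E H b e c"]
        card_Un_le[of "blocked E H b e r" "blocked E H b e c"]
      by linarith
    have fin: "finite (b ` ?N \<union> (blocked E H b e r \<union> blocked E H b e c))"
      using fin_N card_blocked(1)[OF e(1) r, of H b] card_blocked(1)[OF e(1) c, of H b] by simp
    from ex_colour_avoiding[OF fin lt] obtain k where "k \<in> B" "k \<notin> b ` ?N \<union> (blocked E H b e r \<union> blocked E H b e c)"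
      by (rule bexE)
    then have k: "k \<in> B" "k \<notin> b ` ?N" "k \<notin> blocked E H b e r" "k \<notin> blocked E H b e c"
      by (simp_all only: Un_iff de_Morgan_disj simp_thms)
    show ?thesis
    proof (rule distinguishing_on_extend[OF step.prems e(2) _ rc(1) no_loop k(1,2)])
      show "k \<notin> blocked E H b e v" if "v \<in> e" for v using that k rc(1) by blast
      show "card (inc H r) \<noteq> card (inc H c)"
      proof
        assume "card (inc H r) = card (inc H c)"
        then have "card (inc H c) = 1" using rc(2) by simp
        moreover have "e \<in> inc H c" using c e unfolding inc_def by auto
        ultimately show False using rc(3) by (metis card_1_singletonE singletonD)
      qed
    qed auto
  next
    case False
    \<comment> \<open>The edge \<open>f\<close> is still uncoloured, so \<open>x\<close> stays
      incomplete and only the neighbours of \<open>y\<close> block colours.\<close>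
    then obtain x f where x: "x \<in> e" "f \<in> U" "x \<in> f" using step.hyps(4) by blast
    obtain y where y: "e = {x, y}" using e(1) x(1) by (rule edgeE)
    have ye: "y \<in> e" using y by auto
    have f: "f \<in> inc H x" "f \<notin> insert e ?D"
      using x grown_subset[OF step.hyps(1)] step.hyps(3) unfolding inc_def by auto
    have "card ?N \<le> card ((inc H x - {e}) \<union> (inc H y - {e}))"
      using finite_inc[OF H] adj[OF y] by (intro card_mono) simp_all
    then have "card (b ` ?N) \<le> (d - 1) + (d - 1)"
      using card_inc_minus[OF H e(2) x(1)] card_inc_minus[OF H e(2) ye]
        card_Un_le[of "inc H x - {e}" "inc H y - {e}"] card_image_le[OF fin_N, of b]
      by linarith
    then have lt: "card (b ` ?N \<union> blocked E H b e y) < card B"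
      using card_blocked(2)[OF e(1) ye, of H b] B d card_Un_le[of "b ` ?N" "blocked E H b e y"]
      by linarith
    have fin: "finite (b ` ?N \<union> blocked E H b e y)"
      using fin_N card_blocked(1)[OF e(1) ye, of H b] by simp
    from ex_colour_avoiding[OF fin lt] obtain k where "k \<in> B" "k \<notin> b ` ?N \<union> blocked E H b e y"
      by (rule bexE)
    then have k: "k \<in> B" "k \<notin> b ` ?N" "k \<notin> blocked E H b e y"
      by (simp_all only: Un_iff de_Morgan_disj simp_thms)
    have open_x: "\<not> inc H x \<subseteq> insert e ?D" using f by (meson subsetD)
    show ?thesis
    proof (rule distinguishing_on_extend[OF step.prems e(2) _ y no_loop k(1,2)])
      show "k \<notin> blocked E H b e v" if "v \<in> e" "inc H v \<subseteq> insert e ?D" for v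
      proof -
        have "v = y" using that open_x y by (metis insertE singletonD)
        then show ?thesis using k(3) by simp
      qed
      show "card (inc H x) \<noteq> card (inc H y)" if "inc H x \<subseteq> insert e ?D"
        using that open_x by (rule notE[rotated])
    qed auto
  qed
  then show ?case using step.IH D by metis
qed

section \<open>Components and vertices that do not cut them\<close>

lemma component_sym:
  assumes "v \<in> component_of E u"
  shows "component_of E v = component_of E u"
proof -
  let ?R = "{(x, y). {x, y} \<in> E}"
  have "sym ?R" by (auto simp: sym_def insert_commute)
  then have "(v, u) \<in> ?R\<^sup>*" "(u, v) \<in> ?R\<^sup>*"
    using assms sym_rtrancl[of ?R] unfolding component_of_def sym_def by blast+
  then show ?thesis unfolding component_of_def by (blast intro: rtrancl_trans)
qed

lemma component_edge: "{u, v} \<in> E \<Longrightarrow> u \<in> component_of E x \<Longrightarrow> v \<in> component_of E x"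
  unfolding component_of_def by (auto intro: rtrancl_into_rtrancl)

lemma component_refl: "u \<in> component_of E u"
  unfolding component_of_def by simp

definition avoiding :: "'a \<Rightarrow> ('a \<times> 'a) set" where
  "avoiding r = {(x, y). {x, y} \<in> E \<and> x \<noteq> r \<and> y \<noteq> r}"

text \<open>A vertex at maximal distance from \<open>x\<close> is not a cut vertex: shortest paths from \<open>x\<close> to the
  other vertices avoid it.\<close>

lemma ex_non_cut_vertex:
  assumes xy: "{x, y} \<in> E"
  obtains r where "r \<in> component_of E x" "r \<noteq> x"
    "\<And>v. v \<in> component_of E x \<Longrightarrow> v \<noteq> r \<Longrightarrow> (x, v) \<in> (avoiding r)\<^sup>*"
proof -
  let ?R = "{(x, y). {x, y} \<in> E}"
  let ?C = "component_of E x"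
  \<comment> \<open>Distance from \<open>x\<close>.\<close>
  define h where "h v = (LEAST n. (x, v) \<in> ?R ^^ n)" for v
  have h: "(x, v) \<in> ?R ^^ h v" if "v \<in> ?C" for v
  proof -
    have "\<exists>n. (x, v) \<in> ?R ^^ n" using that unfolding component_of_def rtrancl_power by simp
    then show ?thesis unfolding h_def by (rule LeastI_ex)
  qed
  have h_le: "h v \<le> n" if "(x, v) \<in> ?R ^^ n" for v n
    using that unfolding h_def by (rule Least_le)
  have "v \<in> V" if "v \<in> ?C" for v
  proof -
    have "(x, v) \<in> ?R\<^sup>*" using that unfolding component_of_def by simp
    then show ?thesis by induction (use edge_V xy in blast)+
  qed
  then have fin: "finite (h ` ?C)" using finite_V by (meson finite_imageI finite_subset subsetI)
  then have "Max (h ` ?C) \<in> h ` ?C" using component_refl by (intro Max_in) auto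
  then obtain r where "r \<in> ?C" "Max (h ` ?C) = h r" by (rule imageE)
  then have r: "r \<in> ?C" "\<And>v. v \<in> ?C \<Longrightarrow> h v \<le> h r" using Max_ge[OF fin] by auto
  have y: "y \<in> ?C" using component_edge[OF xy component_refl] .
  \<comment> \<open>The neighbour \<open>y\<close> makes the maximal distance positive, which
    separates \<open>r\<close> from \<open>x\<close>.\<close>
  have "h y \<noteq> 0" using h[OF y] edge_ne[OF xy] by (metis pair_in_Id_conv relpow.simps(1))
  moreover have "h x = 0" using h_le[of x 0] by simp
  ultimately have "r \<noteq> x" using r(2)[OF y] by auto
  moreover have "(x, v) \<in> (avoiding r)\<^sup>*" if "v \<in> ?C" "v \<noteq> r" for v
    using that
  proof (induction "h v" arbitrary: v rule: less_induct)
    case less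
    show ?case
    proof (cases "h v")
      case 0
      then show ?thesis using h[OF less.prems(1)] by simp
    next
      case (Suc n)
      then obtain u where u: "(x, u) \<in> ?R ^^ n" "{u, v} \<in> E"
        using h[OF less.prems(1)] by auto
      have "u \<in> ?C" using u(1) relpow_imp_rtrancl unfolding component_of_def by blast
      moreover have "h u < h v" using h_le[OF u(1)] Suc by simp
      \<comment> \<open>The predecessor on a shortest path is strictly closer than \<open>v\<close>,
        while no vertex is farther than \<open>r\<close>.\<close>
      moreover from this have "u \<noteq> r" using r(2)[OF less.prems(1)] by auto
      ultimately have "(x, u) \<in> (avoiding r)\<^sup>*" "(u, v) \<in> avoiding r"
        using less u(2) unfolding avoiding_def by auto
      then show ?thesis by (rule rtrancl_into_rtrancl)
    qed
  qed
  ultimately show ?thesis using that r(1) by blast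
qed

section \<open>Root edges and the partition of the edge set\<close>

text \<open>Deleting \<open>r\<close> leaves the rest of \<open>C\<close> connected. The last
  conjunct says that no vertex becomes isolated, which fails for a component \<open>K2\<close>; it
  will provide an edge of \<open>H\<close> at every vertex other than \<open>r\<close>, and at
  \<open>c\<close> a second one besides \<open>{r, c}\<close>.\<close>

definition root_edge :: "'a set \<Rightarrow> 'a \<Rightarrow> 'a \<Rightarrow> bool" where
  "root_edge C r c \<longleftrightarrow> r \<in> C \<and> c \<in> C \<and> {r, c} \<in> E \<and> (\<forall>v\<in>C - {r}. (c, v) \<in> (avoiding r)\<^sup>*) \<and>
     (\<forall>v\<in>C - {r}. \<exists>u. (v, u) \<in> avoiding r)"

lemma sym_avoiding: "sym (avoiding r)"
  unfolding avoiding_def by (auto simp: sym_def insert_commute)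

text \<open>Take a non-cut vertex as \<open>r\<close>. Since the component is not \<open>K2\<close>,
  it has a third vertex \<open>w\<close>; what remains without \<open>r\<close> is then connected on
  at least two vertices, so none of them is isolated.\<close>

lemma ex_root_edge:
  assumes I: "no_isolated_edges V E" and xy: "{x, y} \<in> E"
  shows "\<exists>r c. root_edge (component_of E x) r c"
proof -
  let ?C = "component_of E x"
  obtain r where r: "r \<in> ?C" "r \<noteq> x" "\<And>v. v \<in> ?C \<Longrightarrow> v \<noteq> r \<Longrightarrow> (x, v) \<in> (avoiding r)\<^sup>*"
    using ex_non_cut_vertex[OF xy] by blast
  \<comment> \<open>The last vertex before \<open>r\<close> on a walk from \<open>x\<close>, which
    is nonempty as \<open>r\<close> differs from \<open>x\<close>.\<close>
  obtain c where c: "c \<in> ?C" "{c, r} \<in> E"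
    using r(1,2) unfolding component_of_def by (auto elim: rtranclE)
  have "c \<noteq> r" using edge_ne[OF c(2)] .
  have conn: "(u, v) \<in> (avoiding r)\<^sup>*" if "u \<in> ?C - {r}" "v \<in> ?C - {r}" for u v
  proof -
    have "(x, u) \<in> (avoiding r)\<^sup>*" "(x, v) \<in> (avoiding r)\<^sup>*" using r(3) that by auto
    moreover from this(1) have "(u, x) \<in> (avoiding r)\<^sup>*"
      by (rule symD[OF sym_rtrancl[OF sym_avoiding]])
    ultimately show ?thesis by (metis rtrancl_trans)
  qed
  have "?C \<noteq> {c, r}"
  proof
    assume C: "?C = {c, r}"
    have "e = {c, r}" if "e \<in> E" "e \<subseteq> {c, r}" for e
      using that G \<open>c \<noteq> r\<close> card_subset_eq[of "{c, r}" e] unfolding simple_graph_def by simp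
    then have "is_K2 {c, r} (induced_edges E {c, r})"
      using c(2) \<open>c \<noteq> r\<close> unfolding is_K2_def induced_edges_def by auto
    moreover have "x \<in> V" using edge_V[OF xy] by simp
    ultimately show False
      using I C unfolding no_isolated_edges_def graph_components_def by (metis imageI)
  qed
  then obtain w where w: "w \<in> ?C" "w \<noteq> c" "w \<noteq> r" using r(1) c(1) by auto
  have "\<exists>u. (v, u) \<in> avoiding r" if v: "v \<in> ?C - {r}" for v
  proof -
    have "c \<in> ?C - {r}" "w \<in> ?C - {r}" using w c(1) \<open>c \<noteq> r\<close> by auto
    then obtain t where "(v, t) \<in> (avoiding r)\<^sup>*" "v \<noteq> t" using conn[OF v] w(2) by metis
    then show ?thesis by (metis converse_rtranclE)
  qed
  moreover have "\<forall>v\<in>?C - {r}. (c, v) \<in> (avoiding r)\<^sup>*" using conn[of c] c(1) \<open>c \<noteq> r\<close> by simp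
  ultimately have "root_edge ?C r c"
    unfolding root_edge_def using r(1) c by (simp add: insert_commute)
  then show ?thesis by blast
qed

text \<open>\<open>H\<close> is to be coloured from the large palette and \<open>E - H\<close>, a
  star at each root, from the small one. The summand 2 in the last bound accounts for the edge
  itself and the root edge; it later leaves room for the colours of the two end points.\<close>

lemma ex_edge_partition:
  assumes I: "no_isolated_edges V E"
  shows "\<exists>H Z. H \<subseteq> E \<and> grown H Z H \<and>
    (\<forall>z\<in>Z. \<exists>r c. z = {r, c} \<and> inc H r = {z} \<and> inc H c \<noteq> {z}) \<and>
    (\<forall>u v. {u, v} \<in> E \<longrightarrow> inc H u \<noteq> {}) \<and>
    (\<forall>e\<in>E - H. card {e' \<in> E - H. e' \<noteq> e \<and> e' \<inter> e \<noteq> {}} + 2 \<le> d)"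
proof -
  define Cs where "Cs = {component_of E x | x. \<exists>y. {x, y} \<in> E}"
  have "\<forall>C\<in>Cs. \<exists>r c. root_edge C r c" using ex_root_edge[OF I] unfolding Cs_def by blast
  then obtain rt ct where rc: "\<And>C. C \<in> Cs \<Longrightarrow> root_edge C (rt C) (ct C)" by metis
  have comp: "C = component_of E v" if "C \<in> Cs" "v \<in> C" for C v
    using that component_sym unfolding Cs_def by blast
  have comp_nbr: "v \<in> C" if "C \<in> Cs" "{u, v} \<in> E" "u \<in> C" for C u v
    using that component_edge unfolding Cs_def by blast
  have uniq: "C = C'" if "C \<in> Cs" "C' \<in> Cs" "v \<in> C" "v \<in> C'" for C C' v
    using comp that by metis
  have rt_C: "rt C \<in> C" "ct C \<in> C" "{rt C, ct C} \<in> E" if "C \<in> Cs" for C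
    using rc[OF that] unfolding root_edge_def by auto
  have in_Cs: "component_of E u \<in> Cs" if "{u, v} \<in> E" for u v
    using that unfolding Cs_def by blast
  define H where "H = {e \<in> E. \<forall>C\<in>Cs. rt C \<in> e \<longrightarrow> e = {rt C, ct C}}"
  define Z where "Z = {{rt C, ct C} | C. C \<in> Cs}"
  have "H \<subseteq> E" unfolding H_def by auto
  have avoiding_H: "{u, v} \<in> H" if C: "C \<in> Cs" "u \<in> C" "(u, v) \<in> avoiding (rt C)" for C u v
  proof -
    have uv: "{u, v} \<in> E" "u \<noteq> rt C" "v \<noteq> rt C" using C(3) unfolding avoiding_def by auto
    then have "v \<in> C" using comp_nbr C by blast
    then have "rt C' \<notin> {u, v}" if "C' \<in> Cs" for C'
      using uniq[OF C(1) that] rt_C(1)[OF that] C(2) uv by auto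
    then show ?thesis using uv(1) unfolding H_def by blast
  qed
  have Z_H: "{rt C, ct C} \<in> H" if C: "C \<in> Cs" for C
  proof -
    have "{rt C, ct C} = {rt C', ct C'}" if "C' \<in> Cs" "rt C' \<in> {rt C, ct C}" for C'
    proof -
      have "rt C' \<in> C" using that(2) rt_C(1,2)[OF C] by auto
      then have "C = C'" using uniq[OF C that(1)] rt_C(1)[OF that(1)] by simp
      then show ?thesis by simp
    qed
    then show ?thesis using rt_C(3)[OF C] unfolding H_def by blast
  qed
  have ex_H: "\<exists>u. u \<noteq> rt C \<and> {v, u} \<in> H" if C: "C \<in> Cs" "v \<in> C" "v \<noteq> rt C" for C v
  proof -
    obtain u where "(v, u) \<in> avoiding (rt C)"
      using rc[OF C(1)] C unfolding root_edge_def by blast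
    then show ?thesis using avoiding_H C unfolding avoiding_def by blast
  qed
  have "grown H Z H"
  proof (rule grown_all)
    show "finite H" using \<open>H \<subseteq> E\<close> finite_E by (rule finite_subset)
    fix U assume U: "U \<subset> H"
    show "\<exists>e\<in>H - U. e \<in> Z \<or> e \<inter> \<Union>U \<noteq> {}"
    proof (rule ccontr)
      \<comment> \<open>A set \<open>U\<close> that cannot grow contains every root edge and every
        edge of \<open>H\<close> that meets it.\<close>
      assume "\<not> ?thesis"
      then have closed: "e \<in> U" if "e \<in> H" "e \<in> Z \<or> e \<inter> \<Union>U \<noteq> {}" for e using that by (metis DiffI)
      obtain e where e: "e \<in> H" "e \<notin> U" using U by blast
      have "e \<in> E" using e(1) \<open>H \<subseteq> E\<close> by (rule subsetD[rotated])
      then have "card e = 2" using G unfolding simple_graph_def by blast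
      then obtain u v where uv: "e = {u, v}" unfolding card_2_iff by (elim exE conjE)
      define C where "C = component_of E u"
      have C: "C \<in> Cs" "u \<in> C"
        using in_Cs[of u v] uv \<open>e \<in> E\<close> component_refl unfolding C_def by auto
      have root: "{rt C, ct C} \<in> U" using closed[OF Z_H[OF C(1)]] C(1) unfolding Z_def by blast
      \<comment> \<open>Walks from \<open>ct C\<close> that avoid the root use edges of
        \<open>H\<close> only, so starting from the root edge they stay inside the vertices covered
        by \<open>U\<close>.\<close>
      have cover: "w \<in> \<Union>U \<and> w \<in> C" if "(ct C, w) \<in> (avoiding (rt C))\<^sup>*" for w
        using that
      proof induction
        case base
        then show ?case using root rt_C[OF C(1)] by blast
      next
        case (step y z)
        then have yz: "{y, z} \<in> H" using avoiding_H[OF C(1)] by simp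
        have "{y, z} \<inter> \<Union>U \<noteq> {}" using step.IH by blast
        then have "{y, z} \<in> U" using closed[OF yz] by simp
        moreover have "z \<in> C" using comp_nbr[OF C(1), of y z] step.IH yz \<open>H \<subseteq> E\<close> by auto
        ultimately show ?case by blast
      qed
      have "u \<in> \<Union>U"
      proof (cases "u = rt C")
        case True
        then show ?thesis using root by blast
      next
        case False
        then have "(ct C, u) \<in> (avoiding (rt C))\<^sup>*"
          using rc[OF C(1)] C(2) unfolding root_edge_def by simp
        then show ?thesis using cover by simp
      qed
      then have "e \<inter> \<Union>U \<noteq> {}" using uv by blast
      then show False using closed[OF e(1)] e(2) by simp
    qed
  qed
  moreover have "\<exists>r c. z = {r, c} \<and> inc H r = {z} \<and> inc H c \<noteq> {z}" if z: "z \<in> Z" for z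
  proof -
    obtain C where C: "C \<in> Cs" "z = {rt C, ct C}" using z unfolding Z_def by blast
    have "e = z" if "e \<in> H" "rt C \<in> e" for e using that C unfolding H_def by blast
    moreover have "z \<in> H" "rt C \<in> z" using Z_H[OF C(1)] C(2) by simp_all
    ultimately have "inc H (rt C) = {z}" unfolding inc_def by blast
    moreover have "inc H (ct C) \<noteq> {z}"
    proof -
      have "ct C \<noteq> rt C" using edge_ne[OF rt_C(3)[OF C(1)]] by simp
      from ex_H[OF C(1) rt_C(2)[OF C(1)] this] obtain u
        where "u \<noteq> rt C" "{ct C, u} \<in> H" by blast
      then have "{ct C, u} \<in> inc H (ct C)" "{ct C, u} \<noteq> z"
        using C(2) \<open>ct C \<noteq> rt C\<close> unfolding inc_def by (auto simp: doubleton_eq_iff)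
      then show ?thesis by blast
    qed
    ultimately show ?thesis using C(2) by blast
  qed
  moreover have "inc H u \<noteq> {}" if uv: "{u, v} \<in> E" for u v
  proof -
    let ?C = "component_of E u"
    have "\<exists>w. {u, w} \<in> H"
    proof (cases "u = rt ?C")
      case True
      have "{rt ?C, ct ?C} \<in> H" using Z_H[OF in_Cs[OF uv]] .
      then show ?thesis unfolding True[symmetric] ..
    next
      case False
      show ?thesis using ex_H[OF in_Cs[OF uv] component_refl False] by (elim exE conjE) (rule exI)
    qed
    then show ?thesis unfolding inc_def by auto
  qed
  moreover have "card {e' \<in> E - H. e' \<noteq> e \<and> e' \<inter> e \<noteq> {}} + 2 \<le> d" if e: "e \<in> E - H" for e
  proof -
    obtain C where C: "C \<in> Cs" "rt C \<in> e" "e \<noteq> {rt C, ct C}" using e unfolding H_def by blast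
    have "e \<in> E" using e by simp
    then obtain u where u: "e = {rt C, u}" using C(2) by (rule edgeE)
    let ?z = "{rt C, ct C}"
    have "u \<in> C" using comp_nbr[OF C(1), of "rt C" u] e u rt_C[OF C(1)] by auto
    \<comment> \<open>An edge outside \<open>H\<close> contains the root of its component, and edges
      that meet lie in the same component.\<close>
    have "rt C \<in> e'" if e': "e' \<in> E - H" "e' \<inter> e \<noteq> {}" for e'
    proof -
      obtain C' where C': "C' \<in> Cs" "rt C' \<in> e'" using e' unfolding H_def by blast
      have "e' \<in> E" using e' by simp
      then obtain w where w: "e' = {rt C', w}" using C'(2) by (rule edgeE)
      have "w \<in> C'" using comp_nbr[OF C'(1), of "rt C'" w] e' w rt_C[OF C'(1)] by auto
      then have "e' \<subseteq> C'" using w rt_C(1)[OF C'(1)] by simp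
      moreover have "e \<subseteq> C" using u \<open>u \<in> C\<close> rt_C(1)[OF C(1)] by simp
      ultimately have "C = C'" using e'(2) uniq[OF C(1) C'(1)] by blast
      then show ?thesis using C'(2) by simp
    qed
    then have "{e' \<in> E - H. e' \<noteq> e \<and> e' \<inter> e \<noteq> {}} \<subseteq> inc E (rt C) - {e, ?z}"
      using Z_H[OF C(1)] unfolding inc_def by auto
    then have "card {e' \<in> E - H. e' \<noteq> e \<and> e' \<inter> e \<noteq> {}} \<le> card (inc E (rt C) - {e, ?z})"
      using finite_inc[of E] by (intro card_mono) auto
    moreover have sub: "{e, ?z} \<subseteq> inc E (rt C)"
      using e C rt_C[OF C(1)] unfolding inc_def by auto
    then have "card (inc E (rt C) - {e, ?z}) = card (inc E (rt C)) - 2"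
      using C(3) by (simp add: card_Diff_subset)
    moreover have "2 \<le> card (inc E (rt C))"
      using card_mono[OF finite_inc sub] C(3) by simp
    moreover have "card (inc E (rt C)) \<le> d" using card_inc[OF subset_refl edge_V[OF \<open>e \<in> E\<close> C(2)]] .
    ultimately show ?thesis by linarith
  qed
  ultimately show ?thesis using \<open>H \<subseteq> E\<close>
    by (intro exI[of _ H] exI[of _ Z] conjI allI ballI impI) simp_all
qed

section \<open>Assembling the total colouring\<close>

text \<open>The palettes are disjoint, so intersecting a colour set with \<open>?B\<close> recovers
  exactly the colours of the edges of \<open>H\<close> at that vertex. Distinctness of these
  suffices, whatever the colours from \<open>?A\<close> are.\<close>

lemma ex_D1_VSDTC:
  assumes I: "no_isolated_edges V E" and "E \<noteq> {}"
  shows "\<exists>f. D1_VSDTC V E (4 * d) f"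
proof -
  obtain H Z where H: "H \<subseteq> E" "grown H Z H"
    and root: "\<forall>z\<in>Z. \<exists>r c. z = {r, c} \<and> inc H r = {z} \<and> inc H c \<noteq> {z}"
    and covered: "\<forall>u v. {u, v} \<in> E \<longrightarrow> inc H u \<noteq> {}"
    and star: "\<forall>e\<in>E - H. card {e' \<in> E - H. e' \<noteq> e \<and> e' \<inter> e \<noteq> {}} + 2 \<le> d"
    using ex_edge_partition[OF I] by (elim exE conjE)
  let ?A = "{1..d + 1}" and ?B = "{d + 2..4 * d}"
  have "\<exists>g. \<forall>x\<in>V. g x \<in> ?A \<and> g x \<notin> {} \<and> (\<forall>y\<in>V. y \<noteq> x \<and> {x, y} \<in> E \<longrightarrow> g x \<noteq> g y)"
  proof (rule greedy_colouring[OF finite_V])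
    show "symp (\<lambda>x y. {x, y} \<in> E)" by (auto simp: symp_def insert_commute)
    fix x assume "x \<in> V"
    have "card {y \<in> V. y \<noteq> x \<and> {x, y} \<in> E} \<le> card (nbh E x)"
      using finite_nbh unfolding nbh_def by (intro card_mono) auto
    then show "card {} + card {y \<in> V. y \<noteq> x \<and> {x, y} \<in> E} < card ?A"
      using card_nbh[OF \<open>x \<in> V\<close>] by simp
  qed simp
  then obtain g where g0: "\<forall>x\<in>V. g x \<in> ?A \<and> g x \<notin> {} \<and>
      (\<forall>y\<in>V. y \<noteq> x \<and> {x, y} \<in> E \<longrightarrow> g x \<noteq> g y)" by (rule exE)
  have g: "g x \<in> ?A" if "x \<in> V" for x using g0 that by simp
  have g_proper: "g x \<noteq> g y" if "{x, y} \<in> E" for x y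
    using g0 that edge_V[OF that] edge_ne[OF that] by simp
  \<comment> \<open>At most two colours are excluded by the end points and \<open>d - 2\<close> by
    other edges of \<open>E - H\<close>, out of \<open>d + 1\<close>.\<close>
  have "\<exists>a. \<forall>e\<in>E - H. a e \<in> ?A \<and> a e \<notin> g ` e \<and>
      (\<forall>e'\<in>E - H. e' \<noteq> e \<and> e' \<inter> e \<noteq> {} \<longrightarrow> a e \<noteq> a e')"
  proof (rule greedy_colouring)
    show "finite (E - H)" using finite_E by simp
    show "symp (\<lambda>e e'. e' \<inter> e \<noteq> {})" by (auto simp: symp_def)
    fix e assume e: "e \<in> E - H"
    have "card e = 2" using e G unfolding simple_graph_def by blast
    then have fin: "finite e" by (metis card.infinite zero_neq_numeral)
    then have "card (g ` e) \<le> 2" using card_image_le[OF fin, of g] \<open>card e = 2\<close> by simp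
    then show "card (g ` e) + card {e' \<in> E - H. e' \<noteq> e \<and> e' \<inter> e \<noteq> {}} < card ?A"
      using star e by force
    show "finite (g ` e)" using fin by simp
  qed
  then obtain a where a0: "\<forall>e\<in>E - H. a e \<in> ?A \<and> a e \<notin> g ` e \<and>
      (\<forall>e'\<in>E - H. e' \<noteq> e \<and> e' \<inter> e \<noteq> {} \<longrightarrow> a e \<noteq> a e')" by (rule exE)
  then have a: "a e \<in> ?A" "a e \<notin> g ` e" if "e \<in> E" "e \<notin> H" for e
    using that by simp_all
  have a_proper: "a e \<noteq> a e'" if "e \<in> E" "e \<notin> H" "e' \<in> E" "e' \<notin> H" "e \<noteq> e'" "e \<inter> e' \<noteq> {}" for e e'
    using a0 that by (simp add: Int_commute)
  obtain e where "e \<in> E" using \<open>E \<noteq> {}\<close> by blast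
  moreover from this have "card e = 2" using G unfolding simple_graph_def by blast
  ultimately obtain u v where uv: "{u, v} \<in> E" by (auto simp: card_2_iff)
  have "0 < d"
  proof -
    have "nbh E u \<noteq> {}" using uv unfolding nbh_def by auto
    then have "0 < card (nbh E u)" using finite_nbh by (simp add: card_gt_0_iff)
    then show ?thesis using card_nbh[of u] edge_V[OF uv, of u] by simp
  qed
  \<comment> \<open>Before any edge is coloured, no end point of an edge is complete, since each has
    an edge of \<open>H\<close>; any function serves as the start.\<close>
  have "distinguishing_on E H ?B (H - H) undefined"
    using covered unfolding distinguishing_on_def by auto
  moreover have "3 * (d - 1) < card ?B" using \<open>0 < d\<close> by simp
  ultimately obtain b where b: "distinguishing_on E H ?B H b"
    using distinguishing_on_all[OF H(1) _ bspec[OF root] H(2), of ?B] by auto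
  note b = b[unfolded distinguishing_on_def]
  have b_B: "b e \<in> ?B" if "e \<in> H" for e
    by (rule subsetD[OF conjunct1[OF b] imageI[OF that]])
  have b_proper: "b e \<noteq> b e'" if "e \<in> H" "e' \<in> H" "e \<noteq> e'" "e \<inter> e' \<noteq> {}" for e e'
    using conjunct1[OF conjunct2[OF b]] that by simp
  have b_dist: "b ` inc H u \<noteq> b ` inc H v" if "{u, v} \<in> E" for u v
  proof -
    have "inc H u \<subseteq> H" "inc H v \<subseteq> H" unfolding inc_def by auto
    then show ?thesis using conjunct2[OF conjunct2[OF b]] that by simp
  qed
  define f where "f = case_sum g (\<lambda>e. if e \<in> H then b e else a e)"
  have f: "f (Inl u) = g u" "f (Inr e) = (if e \<in> H then b e else a e)" for u e
    unfolding f_def by auto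
  have disj: "p \<noteq> q" if "p \<in> ?A" "q \<in> ?B" for p q using that by auto
  have sub: "?A \<subseteq> {1..4 * d}" "?B \<subseteq> {1..4 * d}" using \<open>0 < d\<close> by auto
  have edge_colours: "f (Inr e) \<noteq> f (Inr e')" if "e \<in> E" "e' \<in> E" "e \<noteq> e'" "e \<inter> e' \<noteq> {}" for e e'
    using that a(1) a_proper b_B b_proper disj unfolding f by (cases "e \<in> H"; cases "e' \<in> H") metis+
  have "proper_total_coloring V E (4 * d) f"
    unfolding proper_total_coloring_def
  proof (intro conjI allI ballI impI)
    have "g x \<in> {1..4 * d}" if "x \<in> V" for x using g[OF that] sub by blast
    moreover have "f (Inr e) \<in> {1..4 * d}" if "e \<in> E" for e
      using a(1)[of e] b_B[of e] that sub unfolding f by (cases "e \<in> H") auto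
    ultimately show "f ` elements V E \<subseteq> {1..4 * d}" unfolding elements_def by (auto simp: f(1))
    show "f (Inl x) \<noteq> f (Inl y)" if "{x, y} \<in> E" for x y using g_proper[OF that] by (simp add: f)
    show "f (Inr e) \<noteq> f (Inr e')" if "e \<in> E" "e' \<in> E" "e \<noteq> e' \<and> e \<inter> e' \<noteq> {}" for e e'
      using edge_colours that by blast
    show "f (Inl x) \<noteq> f (Inr e)" if "e \<in> E" "x \<in> e" for x e
    proof (cases "e \<in> H")
      case True
      then show ?thesis using disj[OF g[OF edge_V[OF that]] b_B[OF True]] by (simp add: f)
    next
      case False
      then show ?thesis using a(2)[OF that(1)] imageI[OF that(2), of g] by (auto simp: f)
    qed
  qed
  moreover have "color_set E f x \<inter> ?B = b ` inc H x" if x: "x \<in> V" for x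
  proof
    show "color_set E f x \<inter> ?B \<subseteq> b ` inc H x"
    proof
      fix k assume k: "k \<in> color_set E f x \<inter> ?B"
      then consider y where "y \<in> closed_nbh E x" "k = g y"
        | y where "{x, y} \<in> E" "k = f (Inr {x, y})"
        unfolding color_set_def full_nbh_def nbh_def by (auto simp: f(1))
      then show "k \<in> b ` inc H x"
      proof cases
        case 1
        then have "y \<in> V" using x edge_V unfolding closed_nbh_def nbh_def by blast
        then show ?thesis using g[of y] disj[of "g y" k] k 1 by auto
      next
        case 2
        have "{x, y} \<in> H"
        proof (rule ccontr)
          assume "{x, y} \<notin> H"
          then have "k \<in> ?A" using a(1)[OF 2(1)] 2(2) by (simp add: f)
          then show False using disj[of k k] k by blast
        qed
        then show ?thesis using 2(2) by (simp add: f inc_def)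
      qed
    qed
    show "b ` inc H x \<subseteq> color_set E f x \<inter> ?B"
    proof
      fix k assume "k \<in> b ` inc H x"
      then obtain e where e: "e \<in> H" "x \<in> e" "k = b e" unfolding inc_def by blast
      have "e \<in> E" using e(1) H(1) by blast
      then obtain y where y: "e = {x, y}" using e(2) by (rule edgeE)
      then have "Inr e \<in> full_nbh E x" using e H(1) unfolding full_nbh_def nbh_def by blast
      moreover have "f (Inr e) = k" using e by (simp add: f)
      ultimately show "k \<in> color_set E f x \<inter> ?B"
        using b_B[OF e(1)] e(3) unfolding color_set_def by (metis IntI imageI)
    qed
  qed
  then have "b ` inc H x = color_set E f x \<inter> ?B" if "x \<in> V" for x using that by simp
  then have "color_set E f x \<noteq> color_set E f y" if "{x, y} \<in> E" for x y
    using b_dist[OF that] edge_V[OF that, of x] edge_V[OF that, of y] by force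
  ultimately have "D1_VSDTC V E (4 * d) f" unfolding D1_VSDTC_def by blast
  then show ?thesis by blast
qed

end

theorem corollary1p7:
  fixes V :: "'a set" and E :: "'a set set"
  assumes "simple_graph V E"
    and "E \<noteq> {}"
    and "no_isolated_edges V E"
  shows "chi_1vsdt V E \<le> 4 * max_degree V E"
proof -
  have "finite V" using assms(1) unfolding simple_graph_def by simp
  then interpret sgraph V E "max_degree V E"
    using assms(1) by unfold_locales (auto simp: max_degree_def)
  show ?thesis
    unfolding chi_1vsdt_def using ex_D1_VSDTC[OF assms(3,2)] by (rule Least_le)
qed

end
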